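(* Let $r > 1$ be an integer and let $\{X_{n}, \, n \geqslant 1\}$ be a sequence of random variables stochastically dominated by a random variable $X$ with $\mathbb{E}\lvert X\rvert<\infty$. Let $\{b_{n}\}_{n\geqslant 1}$ be a nondecreasing sequence of positive constants, $\{c_{n}\}_{n\geqslant 1}$ a nonincreasing sequence of nonnegative constants, and $\{a_{n,k}, \, 1 \leqslant k \leqslant n+1, \, n \geqslant 0\}$ an array of positive constants such that (a) $\displaystyle \sum_{k=1}^{n+1} a_{n,k} = O(b_{r^{n}})$ as $n \to \infty$; (b') $\displaystyle \sum_{k=1}^{n+1} r^{k}\,\mathbb{E}\lvert X\rvert I_{\{\lvert X\rvert > b_{r^{k-1}}\}} = o(b_{r^{n}})$ as $n \to \infty$; (c) $\displaystyle \sum_{m=0}^{\infty}\sum_{n=r^{m}}^{r^{m+1}-1} r^{m} c_{n}\,\mathbb{P}\{\lvert X\rvert > b_{r^{m+1}}\} < \infty$; (d) $\displaystyle \sum_{m=0}^{\infty}\sum_{n=r^{m}}^{r^{m+1}-1}\sum_{k=1}^{m+1} \frac{c_{n} r^{m}}{a_{m,k}^{2}}\,\mathbb{E} X^{2} I_{\{\lvert X\rvert \leqslant b_{r^{k}}\}} < \infty$; (e) $\displaystyle \sum_{m=0}^{\infty}\sum_{n=r^{m}}^{r^{m+1}-1}\sum_{k=1}^{m+1} \frac{c_{n} r^{m} b_{r^{k}}^{2}}{a_{m,k}^{2}}\,\mathbb{P}\{\lvert X\rvert > b_{r^{k-1}}\} < \infty$; (f) $\displaystyle \sum_{m=0}^{\infty}\sum_{n=r^{m}}^{r^{m+1}-1}\sum_{k=1}^{m+1}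 \frac{c_{n}}{a_{m,k}^{2}} \max_{1\leqslant \ell\leqslant r-1}\sum_{h=0}^{r^{m-k+1}-1}\left[\sum_{1+hr^{k}\leqslant i<j\leqslant hr^{k}+\ell r^{k-1}} G_{X_{i},X_{j}}(b_{r^{k-1}})\right]^{+} < \infty$; (g) $\displaystyle \sum_{m=0}^{\infty}\sum_{n=r^{m}}^{r^{m+1}-1}\sum_{k=1}^{m+1} \frac{c_{n}}{a_{m,k}^{2}} \sum_{h=0}^{r^{m-k+1}-1}\left[\sum_{1+hr^{k}\leqslant i<j\leqslant hr^{k}+r^{k}} H_{X_{i},X_{j}}(b_{r^{k-1}},b_{r^{k}})\right]^{+} < \infty$. Then $$\sum_{n=1}^{\infty} c_{n}\,\mathbb{P}\left\{\max_{1\leqslant j\leqslant n}\left\lvert\sum_{k=1}^{j}(X_{k}-\mathbb{E} X_{k})\right\rvert > \varepsilon b_{n}\right\} < \infty \quad\text{for all } \varepsilon>0.$$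
   Context: Notation: $x\wedge y=\min\{x,y\}$, $x\vee y=\max\{x,y\}$, $x^{+}=0\vee x$; $I_{A}$ is the indicator of the event $A$. No dependence structure is assumed on the random variables. A sequence $\{X_{n},\,n\geqslant 1\}$ of random variables is stochastically dominated by a random variable $X$ if there is a constant $C>0$ such that $\sup_{n\geqslant 1}\mathbb{P}\{\lvert X_{n}\rvert>t\}\leqslant C\,\mathbb{P}\{\lvert X\rvert>t\}$ for all $t>0$. For real numbers $0<L\leqslant K$, define the truncation $g_{L}(t)=(t\wedge L)\vee(-L)$ and $h_{L,K}(t)=\lvert g_{K}(t)-g_{L}(t)\rvert$. For random variables $X,Y$, define $$G_{X,Y}(L):=\mathrm{Cov}\big(g_{L}(X),g_{L}(Y)\big),\qquad H_{X,Y}(L,K):=\mathrm{Cov}\big(h_{L,K}(X),h_{L,K}(Y)\big).$$ *)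

theory Defs
  imports "HOL-Probability.Probability" "HOL-Library.Landau_Symbols"
begin

text \<open>Only the terms with index \<open>n \<ge> 1\<close> of a sequence are relevant.  The supremum is taken
  over a nonempty set of reals bounded above by \<open>1\<close> when \<open>M\<close> is a probability space.\<close>

definition stoch_dominated :: "'a measure \<Rightarrow> (nat \<Rightarrow> 'a \<Rightarrow> real) \<Rightarrow> ('a \<Rightarrow> real) \<Rightarrow> bool" where
  "stoch_dominated M Xs X \<longleftrightarrow>
     (\<exists>C>0. \<forall>t>0. (SUP n\<in>{1..}. \<P>(\<omega> in M. \<bar>Xs n \<omega>\<bar> > t)) \<le> C * \<P>(\<omega> in M. \<bar>X \<omega>\<bar> > t))"

definition covariance :: "'a measure \<Rightarrow> ('a \<Rightarrow> real) \<Rightarrow> ('a \<Rightarrow> real) \<Rightarrow> real" where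
  "covariance M U V =
     (\<integral>\<omega>. (U \<omega> - (\<integral>\<omega>'. U \<omega>' \<partial>M)) * (V \<omega> - (\<integral>\<omega>'. V \<omega>' \<partial>M)) \<partial>M)"

definition g_trunc :: "real \<Rightarrow> real \<Rightarrow> real" where
  "g_trunc L t = max (min t L) (- L)"

definition h_trunc :: "real \<Rightarrow> real \<Rightarrow> real \<Rightarrow> real" where
  "h_trunc L K t = \<bar>g_trunc K t - g_trunc L t\<bar>"

definition G_cov :: "'a measure \<Rightarrow> ('a \<Rightarrow> real) \<Rightarrow> ('a \<Rightarrow> real) \<Rightarrow> real \<Rightarrow> real" where
  "G_cov M X Y L = covariance M (\<lambda>\<omega>. g_trunc L (X \<omega>)) (\<lambda>\<omega>. g_trunc L (Y \<omega>))"

definition H_cov :: "'a measure \<Rightarrow> ('a \<Rightarrow> real) \<Rightarrow> ('a \<Rightarrow> real) \<Rightarrow> real \<Rightarrow> real \<Rightarrow> real" where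
  "H_cov M X Y L K = covariance M (\<lambda>\<omega>. h_trunc L K (X \<omega>)) (\<lambda>\<omega>. h_trunc L K (Y \<omega>))"

end

theory Submission
  imports Defs
begin

text \<open>
  The sum over \<open>n\<close> is grouped into geometric blocks \<open>r\<^sup>m \<le> n < r\<^sup>m\<^sup>+\<^sup>1\<close>. On one block the maximum over \<open>j \<le> n\<close> is
  replaced by the maximum over all \<open>j < r\<^sup>m\<^sup>+\<^sup>1\<close>, and \<open>b\<^sub>n\<close> by the smaller number \<open>B m = b (r\<^sup>m)\<close>. It is then enough
  to bound a single probability for each \<open>m\<close>.

  No dependence structure is available, so the maximum is not handled by a martingale or
  independence inequality but by chaining along the base \<open>r\<close> digits of \<open>j\<close>, with a truncation level that
  follows the scale: sums over blocks of length about \<open>r\<^sup>k\<close> are formed with the variables truncated at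
  \<open>B (k-1)\<close> or \<open>B k\<close>. Lemma \<open>chaining\<close> bounds every partial sum by one digit block and one full block of
  increments per scale. Neither depends on \<open>j\<close> except through its position, so a union bound over the
  few blocks of each scale together with the Chebyshev inequality controls all \<open>j\<close> at once. The
  variance of a block consists of second moments, which stochastic domination moves onto \<open>X\<close> (lemma
  \<open>dominated_expectation\<close>), and of covariances, which are kept as they are. This gives the
  lemma \<open>maximal_inequality\<close>.

  The thresholds at the different scales are proportional to the numbers \<open>a m k\<close>. By \<open>cond_a\<close> they
  add up to at most a small multiple of \<open>B m\<close>, and by \<open>cond_b'\<close> the bias caused by the truncation is
  \<open>o(B m)\<close>. The remaining five conditions say that the bounds for the probabilities of the bad events, weighted
  with \<open>c n\<close> and added over all blocks, have a finite sum: \<open>cond_c\<close> is for the variables above the highest level,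
  \<open>cond_d\<close> and \<open>cond_e\<close> are for the second moments, \<open>cond_f\<close> and \<open>cond_g\<close> for the covariances of the truncated
  variables and of their increments.
\<close>

section \<open>The truncation functions\<close>

text \<open>These formulas express the truncations through \<open>\<bar>t\<bar>\<close> alone. This is what lets stochastic domination,
  which only controls the law of the absolute value, act on them.\<close>

lemma abs_g_trunc: "0 \<le> L \<Longrightarrow> \<bar>g_trunc L t\<bar> = min \<bar>t\<bar> L"
  by (auto simp: g_trunc_def)

lemma h_trunc_eq: "0 \<le> L \<Longrightarrow> L \<le> K \<Longrightarrow> h_trunc L K t = min \<bar>t\<bar> K - min \<bar>t\<bar> L"
  by (auto simp: h_trunc_def g_trunc_def abs_if min_def max_def)

lemma abs_diff_g_trunc: "0 \<le> K \<Longrightarrow> \<bar>t - g_trunc K t\<bar> = max 0 (\<bar>t\<bar> - K)"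
  by (auto simp: g_trunc_def)

lemma g_trunc_measurable [measurable]: "g_trunc L \<in> borel_measurable borel"
  unfolding g_trunc_def by measurable

lemma h_trunc_measurable [measurable]: "h_trunc L K \<in> borel_measurable borel"
  unfolding h_trunc_def by measurable

section \<open>Moments under stochastic domination\<close>

text \<open>A nonempty superlevel set of a continuous monotone function is an open half line, so the tail events of
  \<open>\<phi> \<bar>U\<bar>\<close> are tail events of \<open>\<bar>U\<bar>\<close>. Since \<open>\<phi> 0 = 0 < t\<close>, continuity keeps the endpoint \<open>s\<close> away from 0, where
  domination says nothing.\<close>

lemma upset_eq_tail:
  fixes \<phi> :: "real \<Rightarrow> real"
  assumes cont: "continuous_on UNIV \<phi>" and mono: "mono_on {0..} \<phi>" and zero: "\<phi> 0 = 0"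
    and t: "0 < t" and ex: "u1 \<ge> 0" "\<phi> u1 > t"
  obtains s where "s > 0" "\<And>u. u \<ge> 0 \<Longrightarrow> \<phi> u > t \<longleftrightarrow> u > s"
proof -
  define S where "S = {u. 0 \<le> u \<and> \<phi> u \<le> t}"
  have le_u1: "u \<le> u1" if "u \<in> S" for u
  proof (rule ccontr)
    assume "\<not> u \<le> u1"
    then have "\<phi> u1 \<le> \<phi> u"
      using ex by (intro mono_onD[OF mono]) auto
    then show False using that ex by (auto simp: S_def)
  qed
  have bdd: "bdd_above S" using le_u1 by (auto simp: bdd_above_def)
  have "0 \<in> S" using zero t by (simp add: S_def)
  have clS: "closed S"
    unfolding S_def
    by (intro closed_Collect_conj closed_Collect_le continuous_intros cont)
  define s where "s = Sup S"
  have sS: "s \<in> S"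
    unfolding s_def using closed_contains_Sup[OF _ bdd clS] \<open>0 \<in> S\<close> by auto
  obtain s0 where s0: "0 \<le> s0" "s0 \<le> u1" "\<phi> s0 = t"
    using IVT'[of \<phi> 0 t u1] continuous_on_subset[OF cont] ex zero t by auto
  have "s0 \<noteq> 0" using s0 zero t by auto
  moreover have "s0 \<le> s" unfolding s_def using s0 by (intro cSup_upper bdd) (auto simp: S_def)
  ultimately have "s > 0" using s0 by auto
  moreover have "\<phi> u > t \<longleftrightarrow> u > s" if "u \<ge> 0" for u
  proof
    assume "\<phi> u > t"
    show "u > s"
    proof (rule ccontr)
      assume "\<not> u > s"
      then have "\<phi> u \<le> \<phi> s" using that by (intro mono_onD[OF mono]) auto
      then show False using sS \<open>\<phi> u > t\<close> by (auto simp: S_def)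
    qed
  next
    assume "u > s"
    then have "u \<notin> S" unfolding s_def using cSup_upper[OF _ bdd] by force
    then show "\<phi> u > t" using that by (auto simp: S_def)
  qed
  ultimately show ?thesis using that by blast
qed

context prob_space
begin

text \<open>Fubini for the region between 0 and the graph of \<open>f\<close>.\<close>

lemma layer_cake:
  fixes f :: "'a \<Rightarrow> real"
  assumes [measurable]: "f \<in> borel_measurable M"
  shows "(\<integral>\<^sup>+\<omega>. ennreal (f \<omega>) \<partial>M) = (\<integral>\<^sup>+t. indicator {0<..} t * emeasure M {\<omega>\<in>space M. f \<omega> > t} \<partial>lborel)"
proof -
  interpret P: pair_sigma_finite M lborel ..
  have "(\<integral>\<^sup>+\<omega>. ennreal (f \<omega>) \<partial>M) = (\<integral>\<^sup>+\<omega>. (\<integral>\<^sup>+t. indicator {0<..<f \<omega>} t \<partial>lborel) \<partial>M)"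
  proof (intro nn_integral_cong)
    show "ennreal (f \<omega>) = (\<integral>\<^sup>+t. indicator {0<..<f \<omega>} t \<partial>lborel)" for \<omega>
      by (cases "0 < f \<omega>") (auto simp: ennreal_neg)
  qed
  also have "\<dots> = (\<integral>\<^sup>+\<omega>. (\<integral>\<^sup>+t. indicator {0<..} t * indicator {p\<in>space (M \<Otimes>\<^sub>M lborel). f (fst p) > snd p} (\<omega>, t) \<partial>lborel) \<partial>M)"
    by (intro nn_integral_cong) (auto simp: indicator_def space_pair_measure)
  also have "\<dots> = (\<integral>\<^sup>+t. (\<integral>\<^sup>+\<omega>. indicator {0<..} t * indicator {p\<in>space (M \<Otimes>\<^sub>M lborel). f (fst p) > snd p} (\<omega>, t) \<partial>M) \<partial>lborel)"
    by (intro P.Fubini'[symmetric]) measurable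
  also have "\<dots> = (\<integral>\<^sup>+t. indicator {0<..} t * emeasure M {\<omega>\<in>space M. f \<omega> > t} \<partial>lborel)"
  proof (intro nn_integral_cong)
    fix t :: real
    have "(\<integral>\<^sup>+\<omega>. indicator {0<..} t * indicator {p\<in>space (M \<Otimes>\<^sub>M lborel). f (fst p) > snd p} (\<omega>, t) \<partial>M)
        = (\<integral>\<^sup>+\<omega>. indicator {0<..} t * indicator {\<omega>\<in>space M. f \<omega> > t} \<omega> \<partial>M)"
      by (intro nn_integral_cong) (auto simp: indicator_def space_pair_measure)
    also have "\<dots> = indicator {0<..} t * emeasure M {\<omega>\<in>space M. f \<omega> > t}"
      by (subst nn_integral_cmult) auto
    finally show "(\<integral>\<^sup>+\<omega>. indicator {0<..} t * indicator {p\<in>space (M \<Otimes>\<^sub>M lborel). f (fst p) > snd p} (\<omega>, t) \<partial>M)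
        = indicator {0<..} t * emeasure M {\<omega>\<in>space M. f \<omega> > t}" .
  qed
  finally show ?thesis .
qed

text \<open>Domination of tails passes to the moments given by continuous monotone \<open>\<phi>\<close> with \<open>\<phi> 0 = 0\<close>: compare the layer cake integrals
  level by level.\<close>

lemma dominated_expectation:
  fixes U V :: "'a \<Rightarrow> real" and \<phi> :: "real \<Rightarrow> real"
  assumes U [measurable]: "U \<in> borel_measurable M" and V [measurable]: "V \<in> borel_measurable M"
    and C: "0 \<le> C"
    and tail: "\<And>t. 0 < t \<Longrightarrow> \<P>(\<omega> in M. \<bar>U \<omega>\<bar> > t) \<le> C * \<P>(\<omega> in M. \<bar>V \<omega>\<bar> > t)"
    and cont: "continuous_on UNIV \<phi>" and mono: "mono_on {0..} \<phi>" and zero: "\<phi> 0 = 0"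
    and int: "integrable M (\<lambda>\<omega>. \<phi> \<bar>V \<omega>\<bar>)"
  shows "integrable M (\<lambda>\<omega>. \<phi> \<bar>U \<omega>\<bar>)"
    and "expectation (\<lambda>\<omega>. \<phi> \<bar>U \<omega>\<bar>) \<le> C * expectation (\<lambda>\<omega>. \<phi> \<bar>V \<omega>\<bar>)"
proof -
  have [measurable]: "\<phi> \<in> borel_measurable borel"
    using cont by (rule borel_measurable_continuous_onI)
  have nonneg: "0 \<le> \<phi> u" if "0 \<le> u" for u
    using mono_onD[OF mono, of 0 u] that zero by auto
  have "(\<integral>\<^sup>+\<omega>. ennreal (\<phi> \<bar>U \<omega>\<bar>) \<partial>M)
      = (\<integral>\<^sup>+t. indicator {0<..} t * emeasure M {\<omega>\<in>space M. \<phi> \<bar>U \<omega>\<bar> > t} \<partial>lborel)"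
    by (intro layer_cake) measurable
  also have "\<dots> \<le> (\<integral>\<^sup>+t. ennreal C * (indicator {0<..} t * emeasure M {\<omega>\<in>space M. \<phi> \<bar>V \<omega>\<bar> > t}) \<partial>lborel)"
  proof (intro nn_integral_mono)
    fix t :: real
    have "emeasure M {\<omega>\<in>space M. \<phi> \<bar>U \<omega>\<bar> > t} \<le> ennreal C * emeasure M {\<omega>\<in>space M. \<phi> \<bar>V \<omega>\<bar> > t}"
      if t: "t > 0"
    proof (cases "\<exists>u\<ge>0. \<phi> u > t")
      case True
      then obtain s where s: "s > 0" "\<And>u. u \<ge> 0 \<Longrightarrow> \<phi> u > t \<longleftrightarrow> u > s"
        using upset_eq_tail[OF cont mono zero t] by metis
      then show ?thesis
        using tail[of s] C by (simp add: emeasure_eq_measure flip: ennreal_mult')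
    next
      case False
      then have "{\<omega>\<in>space M. \<phi> \<bar>U \<omega>\<bar> > t} = {}" by auto
      then show ?thesis by (simp only: emeasure_empty) simp
    qed
    then show "indicator {0<..} t * emeasure M {\<omega>\<in>space M. \<phi> \<bar>U \<omega>\<bar> > t}
        \<le> ennreal C * (indicator {0<..} t * emeasure M {\<omega>\<in>space M. \<phi> \<bar>V \<omega>\<bar> > t})"
      by (auto simp: indicator_def)
  qed
  also have "\<dots> = ennreal C * (\<integral>\<^sup>+t. indicator {0<..} t * emeasure M {\<omega>\<in>space M. \<phi> \<bar>V \<omega>\<bar> > t} \<partial>lborel)"
    by (intro nn_integral_cmult) measurable
  also have "(\<integral>\<^sup>+t. indicator {0<..} t * emeasure M {\<omega>\<in>space M. \<phi> \<bar>V \<omega>\<bar> > t} \<partial>lborel)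
      = (\<integral>\<^sup>+\<omega>. ennreal (\<phi> \<bar>V \<omega>\<bar>) \<partial>M)"
    by (intro layer_cake[symmetric]) measurable
  also have "\<dots> = ennreal (expectation (\<lambda>\<omega>. \<phi> \<bar>V \<omega>\<bar>))"
    by (intro nn_integral_eq_integral int) (simp add: nonneg)
  finally have le: "(\<integral>\<^sup>+\<omega>. ennreal (\<phi> \<bar>U \<omega>\<bar>) \<partial>M) \<le> ennreal (C * expectation (\<lambda>\<omega>. \<phi> \<bar>V \<omega>\<bar>))"
    using C by (simp add: ennreal_mult')
  show int': "integrable M (\<lambda>\<omega>. \<phi> \<bar>U \<omega>\<bar>)"
    using le by (intro integrableI_bounded) (auto simp: nonneg le_less_trans[OF _ ennreal_less_top])
  have "ennreal (expectation (\<lambda>\<omega>. \<phi> \<bar>U \<omega>\<bar>)) \<le> ennreal (C * expectation (\<lambda>\<omega>. \<phi> \<bar>V \<omega>\<bar>))"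
    using le by (subst nn_integral_eq_integral[symmetric, OF int']) (simp_all add: nonneg)
  then show "expectation (\<lambda>\<omega>. \<phi> \<bar>U \<omega>\<bar>) \<le> C * expectation (\<lambda>\<omega>. \<phi> \<bar>V \<omega>\<bar>)"
    using C by (subst (asm) ennreal_le_iff) (simp_all add: nonneg)
qed

lemma bounded_integrable:
  fixes f :: "'a \<Rightarrow> real"
  shows "f \<in> borel_measurable M \<Longrightarrow> (\<And>\<omega>. \<omega> \<in> space M \<Longrightarrow> \<bar>f \<omega>\<bar> \<le> K) \<Longrightarrow> integrable M f"
  by (rule integrable_const_bound[of f K]) auto

end

section \<open>A Chebyshev bound with pairwise covariances\<close>

text \<open>Splits the double sum into the diagonal and the two triangles, which are exchanged by
  transposition.\<close>

lemma sum_symmetric_matrix: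
  fixes f :: "nat \<Rightarrow> nat \<Rightarrow> real"
  assumes "finite I" and sym: "\<And>i j. f i j = f j i"
  shows "(\<Sum>i\<in>I. \<Sum>j\<in>I. f i j) = (\<Sum>i\<in>I. f i i) + 2 * (\<Sum>(i, j) | i \<in> I \<and> j \<in> I \<and> i < j. f i j)"
proof -
  define P where "P = {(i, j). i \<in> I \<and> j \<in> I \<and> i < j}"
  have P: "finite P" by (rule finite_subset[of _ "I \<times> I"]) (auto simp: P_def assms)
  have "(\<Sum>i\<in>I. \<Sum>j\<in>I. f i j) = (\<Sum>(i, j)\<in>I \<times> I. f i j)"
    by (simp add: sum.cartesian_product)
  also have "I \<times> I = ((\<lambda>i. (i, i)) ` I \<union> P) \<union> prod.swap ` P"
    by (force simp: P_def image_iff)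
  also have "(\<Sum>(i, j)\<in>((\<lambda>i. (i, i)) ` I \<union> P) \<union> prod.swap ` P. f i j)
      = (\<Sum>(i, j)\<in>(\<lambda>i. (i, i)) ` I. f i j) + (\<Sum>(i, j)\<in>P. f i j) + (\<Sum>(i, j)\<in>prod.swap ` P. f i j)"
    using P assms(1) by (subst sum.union_disjoint, (auto simp: P_def)[3])+ simp
  also have "(\<Sum>(i, j)\<in>(\<lambda>i. (i, i)) ` I. f i j) = (\<Sum>i\<in>I. f i i)"
    by (subst sum.reindex) (auto simp: inj_on_def)
  also have "(\<Sum>(i, j)\<in>prod.swap ` P. f i j) = (\<Sum>(i, j)\<in>P. f i j)"
    by (subst sum.reindex) (auto simp: inj_on_def case_prod_beta sym intro!: sum.cong)
  finally show ?thesis by (simp add: P_def)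
qed

text \<open>The variance of a sum is the sum of the variances plus twice the sum of the covariances over
  pairs; without any independence the covariances stay in the bound, and only their positive total
  matters. Hence the positive parts of block sums of covariances in \<open>cond_f\<close> and \<open>cond_g\<close>.\<close>

lemma (in prob_space) prob_centered_sum_gt_le:
  fixes U :: "nat \<Rightarrow> 'a \<Rightarrow> real"
  assumes I: "finite I" and U: "\<And>i. i \<in> I \<Longrightarrow> U i \<in> borel_measurable M"
    and bd: "\<And>i \<omega>. i \<in> I \<Longrightarrow> \<bar>U i \<omega>\<bar> \<le> K" and t: "0 < t"
  shows "\<P>(\<omega> in M. \<bar>\<Sum>i\<in>I. U i \<omega> - expectation (U i)\<bar> > t)
    \<le> ((\<Sum>i\<in>I. expectation (\<lambda>\<omega>. (U i \<omega>)\<^sup>2)) + 2 * max 0 (\<Sum>(i, j) | i \<in> I \<and> j \<in> I \<and> i < j. covariance M (U i) (U j))) / t\<^sup>2"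
proof -
  define W where "W i \<omega> = U i \<omega> - expectation (U i)" for i \<omega>
  have [measurable]: "W i \<in> borel_measurable M" if "i \<in> I" for i
    using U[OF that] unfolding W_def by measurable
  have intU: "integrable M (U i)" if "i \<in> I" for i
    using bounded_integrable[OF U[OF that] bd[OF that]] .
  have bdW: "\<bar>W i \<omega>\<bar> \<le> K + \<bar>expectation (U i)\<bar>" if "i \<in> I" for i \<omega>
    using bd[OF that, of \<omega>] unfolding W_def by linarith
  have intWW: "integrable M (\<lambda>\<omega>. W i \<omega> * W j \<omega>)" if "i \<in> I" "j \<in> I" for i j
    using that bdW[OF that(1)] bdW[OF that(2)]
    by (intro bounded_integrable[of _ "(K + \<bar>expectation (U i)\<bar>) * (K + \<bar>expectation (U j)\<bar>)"])
       (auto simp: abs_mult intro!: mult_mono order_trans[OF abs_ge_zero bdW])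
  have intU2: "integrable M (\<lambda>\<omega>. (U i \<omega>)\<^sup>2)" if "i \<in> I" for i
    using that bd[OF that] U[OF that]
    by (intro bounded_integrable[of _ "K\<^sup>2"]) (auto simp: abs_le_square_iff[symmetric] intro: order_trans[OF _ abs_ge_self])
  have sq: "(\<Sum>i\<in>I. W i \<omega>)\<^sup>2 = (\<Sum>i\<in>I. \<Sum>j\<in>I. W i \<omega> * W j \<omega>)" for \<omega>
    by (simp add: power2_eq_square sum_product)
  have EW: "expectation (W i) = 0" if "i \<in> I" for i
    using intU[OF that] unfolding W_def by (simp add: prob_space)
  have intW: "integrable M (W i)" if "i \<in> I" for i
    using intU[OF that] unfolding W_def by simp
  have ES: "expectation (\<lambda>\<omega>. \<Sum>i\<in>I. W i \<omega>) = 0"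
    using intW EW by (subst Bochner_Integration.integral_sum) auto
  have "\<P>(\<omega> in M. \<bar>\<Sum>i\<in>I. W i \<omega>\<bar> > t) \<le> \<P>(\<omega> in M. t \<le> \<bar>(\<Sum>i\<in>I. W i \<omega>) - expectation (\<lambda>\<omega>. \<Sum>i\<in>I. W i \<omega>)\<bar>)"
    unfolding ES by (intro finite_measure_mono) auto
  also have "\<dots> \<le> variance (\<lambda>\<omega>. \<Sum>i\<in>I. W i \<omega>) / t\<^sup>2"
    by (intro Chebyshev_inequality t) (auto simp: sq intro!: intWW)
  also have "variance (\<lambda>\<omega>. \<Sum>i\<in>I. W i \<omega>) = (\<Sum>i\<in>I. \<Sum>j\<in>I. expectation (\<lambda>\<omega>. W i \<omega> * W j \<omega>))"
    unfolding ES using intWW by (simp add: sq)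
  also have "\<dots> = (\<Sum>i\<in>I. expectation (\<lambda>\<omega>. W i \<omega> * W i \<omega>)) +
      2 * (\<Sum>(i, j) | i \<in> I \<and> j \<in> I \<and> i < j. expectation (\<lambda>\<omega>. W i \<omega> * W j \<omega>))"
    by (intro sum_symmetric_matrix I) (simp add: mult.commute)
  also have "\<dots> \<le> (\<Sum>i\<in>I. expectation (\<lambda>\<omega>. (U i \<omega>)\<^sup>2)) +
      2 * max 0 (\<Sum>(i, j) | i \<in> I \<and> j \<in> I \<and> i < j. covariance M (U i) (U j))"
  proof (intro add_mono mult_left_mono sum_mono)
    fix i assume i: "i \<in> I"
    have "expectation (\<lambda>\<omega>. W i \<omega> * W i \<omega>) = variance (U i)"
      by (simp add: W_def power2_eq_square)
    also have "\<dots> \<le> expectation (\<lambda>\<omega>. (U i \<omega>)\<^sup>2)"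
      using variance_eq[OF intU[OF i] intU2[OF i]] by simp
    finally show "expectation (\<lambda>\<omega>. W i \<omega> * W i \<omega>) \<le> expectation (\<lambda>\<omega>. (U i \<omega>)\<^sup>2)" .
  qed (auto simp: covariance_def W_def)
  finally show ?thesis
    using t by (simp add: W_def divide_right_mono)
qed

section \<open>Base r chaining of partial sums\<close>

text \<open>Cut the initial segment up to \<open>j\<close> along the base \<open>r\<close> digits of \<open>j\<close>. Write \<open>j\<^sub>k\<close> for \<open>j\<close> with its \<open>k\<close>
  lowest digits replaced by 0. On the stretch from \<open>j\<^sub>k\<^sub>+\<^sub>1\<close> to \<open>j\<close>, passing from level \<open>k + 1\<close> to level \<open>k\<close>
  of \<open>y\<close> has two costs: the replacement of \<open>y (k+1)\<close> by \<open>y k\<close>, controlled by a sum of nonnegative terms and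
  hence by the sum of \<open>z (k+1)\<close> over the whole surrounding block of length \<open>r\<^sup>k\<^sup>+\<^sup>1\<close>; and the digit block of
  \<open>l r\<^sup>k\<close> terms, where \<open>l\<close> is the digit, on which \<open>y k\<close> is kept. What remains is the stretch from \<open>j\<^sub>k\<close> to \<open>j\<close> of fewer than
  \<open>r\<^sup>k\<close> terms at level \<open>k\<close>, and at level 0 nothing is left.

  The gain is that level \<open>k\<close> only involves blocks that start at a multiple of \<open>r\<^sup>k\<^sup>+\<^sup>1\<close>: there are few of
  them, and they do not depend on \<open>j\<close>.\<close>

lemma chaining:
  fixes y z :: "nat \<Rightarrow> nat \<Rightarrow> real" and \<alpha> \<beta> :: "nat \<Rightarrow> real"
  assumes step: "\<And>k i. k \<le> m \<Longrightarrow> 1 \<le> i \<Longrightarrow> \<bar>y (Suc k) i - y k i\<bar> \<le> z (Suc k) i"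
    and \<alpha>_nonneg: "\<And>k. k \<le> m \<Longrightarrow> 0 \<le> \<alpha> (Suc k)"
    and y_block: "\<And>k h l. k \<le> m \<Longrightarrow> h < r ^ (m - k) \<Longrightarrow> l \<in> {1..r-1} \<Longrightarrow>
      \<bar>\<Sum>i\<in>{h * r ^ Suc k<..h * r ^ Suc k + l * r ^ k}. y k i\<bar> \<le> \<alpha> (Suc k)"
    and z_block: "\<And>k h. k \<le> m \<Longrightarrow> h < r ^ (m - k) \<Longrightarrow>
      (\<Sum>i\<in>{h * r ^ Suc k<..h * r ^ Suc k + r ^ Suc k}. z (Suc k) i) \<le> \<beta> (Suc k)"
    and j: "j < r ^ Suc m"
  shows "\<bar>\<Sum>i=1..j. y (Suc m) i\<bar> \<le> (\<Sum>k=1..Suc m. \<alpha> k + \<beta> k)"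
proof -
  have "\<bar>\<Sum>i\<in>{q * r ^ k<..q * r ^ k + s}. y k i\<bar> \<le> (\<Sum>k'=1..k. \<alpha> k' + \<beta> k')"
    if "k \<le> Suc m" "q < r ^ (Suc m - k)" "s < r ^ k" for k q s
    using that
  proof (induction k arbitrary: q s)
    case 0
    then show ?case by simp
  next
    case (Suc k)
    then have k: "k \<le> m" and q: "q < r ^ (m - k)" by auto
    have "0 < r" using Suc.prems(3) by (cases r) auto
    define l s' where "l = s div r ^ k" and "s' = s mod r ^ k"
    have s: "s = l * r ^ k + s'" by (simp only: l_def s'_def div_mult_mod_eq)
    have s': "s' < r ^ k" using \<open>0 < r\<close> by (simp add: s'_def)
    have l: "l < r" using Suc.prems(3) by (simp add: l_def less_mult_imp_div_less)
    let ?p = "q * r ^ Suc k"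
    \<comment> \<open>The last stretch starts at a multiple of \<open>r\<^sup>k\<close>, as the induction hypothesis requires.\<close>
    have bnd: "(q * r + l) * r ^ k = ?p + l * r ^ k" by (simp add: algebra_simps)
    have "q * r + l < r ^ (Suc m - k)"
    proof -
      have "q * r + l < (q + 1) * r" using l by simp
      also have "\<dots> \<le> r ^ (m - k) * r" using q by (intro mult_right_mono) auto
      also have "\<dots> = r ^ (Suc m - k)" using k by (simp add: Suc_diff_le)
      finally show ?thesis .
    qed
    then have IH: "\<bar>\<Sum>i\<in>{?p + l * r ^ k<..?p + l * r ^ k + s'}. y k i\<bar> \<le> (\<Sum>k'=1..k. \<alpha> k' + \<beta> k')"
      using Suc.IH[of "q * r + l" s'] k s' unfolding bnd by simp
    have "\<bar>\<Sum>i\<in>{?p<..?p + s}. y (Suc k) i - y k i\<bar> \<le> (\<Sum>i\<in>{?p<..?p + s}. z (Suc k) i)"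
      using k by (intro order_trans[OF sum_abs] sum_mono step) auto
    also have "\<dots> \<le> (\<Sum>i\<in>{?p<..?p + r ^ Suc k}. z (Suc k) i)"
      using Suc.prems(3) k by (intro sum_mono2) (auto intro: order_trans[OF abs_ge_zero step])
    also have "\<dots> \<le> \<beta> (Suc k)" using z_block k q by blast
    finally have 1: "\<bar>\<Sum>i\<in>{?p<..?p + s}. y (Suc k) i - y k i\<bar> \<le> \<beta> (Suc k)" .
    \<comment> \<open>The digit 0 gives an empty block, so only the digits \<open>1, \<dots>, r - 1\<close> need a bound.\<close>
    have 2: "\<bar>\<Sum>i\<in>{?p<..?p + l * r ^ k}. y k i\<bar> \<le> \<alpha> (Suc k)"
    proof (cases "l = 0")
      case True
      then show ?thesis using \<alpha>_nonneg k by simp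
    next
      case False
      then show ?thesis using y_block[OF k q, of l] l by simp
    qed
    have "{?p<..?p + s} = {?p<..?p + l * r ^ k} \<union> {?p + l * r ^ k<..?p + l * r ^ k + s'}"
      by (auto simp: s)
    then have "(\<Sum>i\<in>{?p<..?p + s}. y k i) = (\<Sum>i\<in>{?p<..?p + l * r ^ k}. y k i)
        + (\<Sum>i\<in>{?p + l * r ^ k<..?p + l * r ^ k + s'}. y k i)"
      by (simp only:) (intro sum.union_disjoint, auto)
    then have "(\<Sum>i\<in>{?p<..?p + s}. y (Suc k) i) = (\<Sum>i\<in>{?p<..?p + s}. y (Suc k) i - y k i)
        + (\<Sum>i\<in>{?p<..?p + l * r ^ k}. y k i)
        + (\<Sum>i\<in>{?p + l * r ^ k<..?p + l * r ^ k + s'}. y k i)"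
      by (simp add: sum_subtractf)
    then show ?case using 1 2 IH by simp
  qed
  from this[of "Suc m" 0 j] j show ?thesis
    by (simp add: atLeastSucAtMost_greaterThanAtMost)
qed

section \<open>Series summed along geometric blocks\<close>

text \<open>The blocks from \<open>r\<^sup>m\<close> to \<open>r\<^sup>m\<^sup>+\<^sup>1 - 1\<close> tile the positive integers, so the block sums bound all partial
  sums.\<close>

lemma summable_of_blocks:
  fixes u :: "nat \<Rightarrow> real"
  assumes r: "1 < r" and u: "\<And>n. 1 \<le> n \<Longrightarrow> 0 \<le> u n"
    and sm: "summable (\<lambda>m. \<Sum>n=r ^ m..r ^ (m + 1) - 1. u n)"
  shows "summable (\<lambda>n. u (n + 1))"
proof (rule bounded_imp_summable)
  let ?b = "\<lambda>m. \<Sum>n=r ^ m..r ^ (m + 1) - 1. u n"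
  have pos: "1 \<le> r ^ m" for m using r by simp
  have nonneg: "0 \<le> ?b m" for m using pos[of m] by (intro sum_nonneg u) auto
  have blocks: "(\<Sum>n=1..<r ^ M. u n) = (\<Sum>m<M. ?b m)" for M
  proof (induction M)
    case (Suc M)
    have "{1..<r ^ Suc M} = {1..<r ^ M} \<union> {r ^ M..r ^ (M + 1) - 1}"
    proof -
      have "r ^ M \<le> r ^ Suc M" using r by (intro power_increasing) auto
      moreover have "r ^ (M + 1) = r ^ Suc M" by simp
      ultimately show ?thesis
        using pos[of M] by (simp only: set_eq_iff Un_iff atLeastLessThan_iff atLeastAtMost_iff) linarith
    qed
    then have "(\<Sum>n=1..<r ^ Suc M. u n) = (\<Sum>n=1..<r ^ M. u n) + ?b M"
      by (simp only:) (intro sum.union_disjoint, auto)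
    then show ?case using Suc by simp
  qed simp
  fix N
  have "(\<Sum>n\<le>N. u (n + 1)) = (\<Sum>n=1..N+1. u n)"
    by (rule sum.reindex_bij_witness[of _ "\<lambda>n. n - 1" "\<lambda>n. n + 1"]) auto
  also have "\<dots> \<le> (\<Sum>n=1..<r ^ (N + 2). u n)"
  proof (rule sum_mono2)
    have "N + 2 < r ^ (N + 2)" using r by (intro power_gt_expt) auto
    then show "{1..N+1} \<subseteq> {1..<r ^ (N + 2)}" by auto
  qed (auto intro: u)
  also have "\<dots> \<le> (\<Sum>m. ?b m)"
    unfolding blocks using nonneg by (intro sum_le_suminf sm) auto
  finally show "(\<Sum>n\<le>N. u (n + 1)) \<le> (\<Sum>m. ?b m)" .
qed (auto intro: u)

section \<open>Truncated moments of a dominated sequence\<close>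

text \<open>The constant \<open>C\<close> of the domination is fixed here, with the comparison stated for each index in
  place of the supremum.\<close>

locale dominated_sequence = prob_space M
  for M :: "'a measure" +
  fixes Xs :: "nat \<Rightarrow> 'a \<Rightarrow> real" and X :: "'a \<Rightarrow> real" and C :: real
  assumes Xs_rv: "\<And>n. 1 \<le> n \<Longrightarrow> Xs n \<in> borel_measurable M"
    and X_rv [measurable]: "X \<in> borel_measurable M"
    and X_int: "integrable M (\<lambda>\<omega>. \<bar>X \<omega>\<bar>)"
    and C_nonneg: "0 \<le> C"
    and tail: "\<And>n t. 1 \<le> n \<Longrightarrow> 0 < t \<Longrightarrow>
      \<P>(\<omega> in M. \<bar>Xs n \<omega>\<bar> > t) \<le> C * \<P>(\<omega> in M. \<bar>X \<omega>\<bar> > t)"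
begin

lemmas moment_dominated = dominated_expectation[OF Xs_rv X_rv C_nonneg tail]

definition tail_mean :: "real \<Rightarrow> real" where
  "tail_mean K = (\<integral>\<omega>. \<bar>X \<omega>\<bar> * indicator {\<omega>. \<bar>X \<omega>\<bar> > K} \<omega> \<partial>M)"

text \<open>Up to the factor \<open>C\<close> this dominates the second moments of \<open>g_trunc L\<close> and of \<open>h_trunc L K\<close> at once. With
  consecutive levels \<open>L = b (r\<^sup>k\<^sup>-\<^sup>1)\<close> and \<open>K = b (r\<^sup>k)\<close> its two summands are the quantities in \<open>cond_d\<close> and \<open>cond_e\<close>.\<close>

definition trunc_moment :: "real \<Rightarrow> real \<Rightarrow> real" where
  "trunc_moment L K = (\<integral>\<omega>. (X \<omega>)\<^sup>2 * indicator {\<omega>. \<bar>X \<omega>\<bar> \<le> K} \<omega> \<partial>M)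
     + K\<^sup>2 * \<P>(\<omega> in M. \<bar>X \<omega>\<bar> > L)"

lemma tail_mean_integrable: "integrable M (\<lambda>\<omega>. \<bar>X \<omega>\<bar> * indicator {\<omega>. \<bar>X \<omega>\<bar> > K} \<omega>)"
  by (rule Bochner_Integration.integrable_bound[OF X_int]) (auto simp: indicator_def)

lemma tail_mean_nonneg: "0 \<le> tail_mean K"
  unfolding tail_mean_def by (intro integral_nonneg_AE) auto

lemma trunc_moment_nonneg: "0 \<le> trunc_moment L K"
  unfolding trunc_moment_def by (intro add_nonneg_nonneg integral_nonneg_AE mult_nonneg_nonneg) auto

lemma Xs_integrable: "1 \<le> n \<Longrightarrow> integrable M (Xs n)"
  using moment_dominated(1)[of n "\<lambda>t. t"] X_int
  by (auto simp: mono_on_def Xs_rv intro: continuous_intros integrable_abs_cancel)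

lemma g_trunc_Xs_integrable: "1 \<le> n \<Longrightarrow> 0 \<le> K \<Longrightarrow> integrable M (\<lambda>\<omega>. g_trunc K (Xs n \<omega>))"
  using Xs_rv[of n] by (intro bounded_integrable[of _ K]) (auto simp: abs_g_trunc)

text \<open>As functions of \<open>\<bar>t\<bar>\<close>, both \<open>h_trunc L K\<close> and the truncation error of \<open>g_trunc L\<close> are nondecreasing, vanish up
  to \<open>L\<close>, and never exceed \<open>\<bar>t\<bar>\<close>. Hence domination bounds their means by the tail mean of \<open>X\<close> beyond \<open>L\<close>.\<close>

lemma mean_h_trunc_le:
  assumes "1 \<le> n" "0 \<le> L" "L \<le> K"
  shows "expectation (\<lambda>\<omega>. h_trunc L K (Xs n \<omega>)) \<le> C * tail_mean L"
proof -
  let ?\<phi> = "\<lambda>t. min t K - min t L"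
  have int: "integrable M (\<lambda>\<omega>. ?\<phi> \<bar>X \<omega>\<bar>)"
    using assms by (intro bounded_integrable[of _ K]) auto
  have "expectation (\<lambda>\<omega>. ?\<phi> \<bar>Xs n \<omega>\<bar>) \<le> C * expectation (\<lambda>\<omega>. ?\<phi> \<bar>X \<omega>\<bar>)"
    using assms by (intro moment_dominated(2) int) (auto simp: mono_on_def intro!: continuous_intros)
  also have "expectation (\<lambda>\<omega>. ?\<phi> \<bar>X \<omega>\<bar>) \<le> tail_mean L"
    unfolding tail_mean_def using assms
    by (intro integral_mono int tail_mean_integrable) (auto simp: indicator_def)
  finally show ?thesis using assms C_nonneg by (simp add: h_trunc_eq mult_left_mono)
qed

lemma mean_g_trunc_diff_le:
  assumes "1 \<le> n" "0 \<le> K"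
  shows "\<bar>expectation (Xs n) - expectation (\<lambda>\<omega>. g_trunc K (Xs n \<omega>))\<bar> \<le> C * tail_mean K"
proof -
  let ?\<phi> = "\<lambda>t. max 0 (t - K)"
  have int: "integrable M (\<lambda>\<omega>. ?\<phi> \<bar>X \<omega>\<bar>)"
    using assms by (intro Bochner_Integration.integrable_bound[OF X_int]) auto
  have "\<bar>expectation (Xs n) - expectation (\<lambda>\<omega>. g_trunc K (Xs n \<omega>))\<bar>
      = \<bar>expectation (\<lambda>\<omega>. Xs n \<omega> - g_trunc K (Xs n \<omega>))\<bar>"
    using assms Xs_integrable g_trunc_Xs_integrable by simp
  also have "\<dots> \<le> expectation (\<lambda>\<omega>. \<bar>Xs n \<omega> - g_trunc K (Xs n \<omega>)\<bar>)"
    by (rule integral_abs_bound)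
  also have "\<dots> = expectation (\<lambda>\<omega>. ?\<phi> \<bar>Xs n \<omega>\<bar>)"
    using assms by (simp add: abs_diff_g_trunc)
  also have "\<dots> \<le> C * expectation (\<lambda>\<omega>. ?\<phi> \<bar>X \<omega>\<bar>)"
    using assms by (intro moment_dominated(2) int) (auto simp: mono_on_def intro!: continuous_intros)
  also have "expectation (\<lambda>\<omega>. ?\<phi> \<bar>X \<omega>\<bar>) \<le> tail_mean K"
    unfolding tail_mean_def using assms
    by (intro integral_mono int tail_mean_integrable) (auto simp: indicator_def)
  finally show ?thesis using C_nonneg by (simp add: mult_left_mono)
qed

text \<open>Where \<open>\<bar>X\<bar> \<le> K\<close> use \<open>\<phi> t \<le> t\<close>; elsewhere \<open>\<bar>X\<bar> > K \<ge> L\<close>, and \<open>\<phi>\<close> is at most \<open>K\<close>.\<close>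

lemma second_moment_le:
  assumes n: "1 \<le> n" and LK: "0 \<le> L" "L \<le> K"
    and cont: "continuous_on UNIV \<phi>" and mono: "mono_on {0..} \<phi>" and zero: "\<phi> 0 = 0"
    and small: "\<And>t. 0 \<le> t \<Longrightarrow> \<phi> t \<le> t" and K: "\<And>t. \<phi> t \<le> K"
    and eq: "\<And>t. (f t)\<^sup>2 = (\<phi> \<bar>t\<bar>)\<^sup>2"
  shows "expectation (\<lambda>\<omega>. (f (Xs n \<omega>))\<^sup>2) \<le> C * trunc_moment L K"
proof -
  have nonneg: "0 \<le> \<phi> t" if "0 \<le> t" for t using mono_onD[OF mono, of 0 t] zero that by auto
  have [measurable]: "\<phi> \<in> borel_measurable borel"
    using cont by (rule borel_measurable_continuous_onI)
  have int: "integrable M (\<lambda>\<omega>. (\<phi> \<bar>X \<omega>\<bar>)\<^sup>2)"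
    using K nonneg by (intro bounded_integrable[of _ "K\<^sup>2"]) (auto intro!: power_mono)
  have int1: "integrable M (\<lambda>\<omega>. (X \<omega>)\<^sup>2 * indicator {\<omega>. \<bar>X \<omega>\<bar> \<le> K} \<omega>)"
    using LK by (intro bounded_integrable[of _ "K\<^sup>2"])
      (auto simp: indicator_def abs_le_square_iff[symmetric])
  have int2: "integrable M (\<lambda>\<omega>. K\<^sup>2 * indicator {\<omega>\<in>space M. \<bar>X \<omega>\<bar> > L} \<omega>)"
    by (intro bounded_integrable[of _ "K\<^sup>2"]) (auto simp: indicator_def)
  have "expectation (\<lambda>\<omega>. (\<phi> \<bar>Xs n \<omega>\<bar>)\<^sup>2) \<le> C * expectation (\<lambda>\<omega>. (\<phi> \<bar>X \<omega>\<bar>)\<^sup>2)"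
    using n nonneg zero
    by (intro moment_dominated(2)[where \<phi> = "\<lambda>t. (\<phi> t)\<^sup>2"] int continuous_on_power cont)
       (auto simp: mono_on_def intro!: power_mono mono_onD[OF mono])
  also have "expectation (\<lambda>\<omega>. (\<phi> \<bar>X \<omega>\<bar>)\<^sup>2)
      \<le> expectation (\<lambda>\<omega>. (X \<omega>)\<^sup>2 * indicator {\<omega>. \<bar>X \<omega>\<bar> \<le> K} \<omega> + K\<^sup>2 * indicator {\<omega>\<in>space M. \<bar>X \<omega>\<bar> > L} \<omega>)"
  proof (intro integral_mono int Bochner_Integration.integrable_add int1 int2)
    fix \<omega> assume \<omega>: "\<omega> \<in> space M"
    have 1: "(\<phi> \<bar>X \<omega>\<bar>)\<^sup>2 \<le> (X \<omega>)\<^sup>2"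
      using power_mono[OF small[of "\<bar>X \<omega>\<bar>"] nonneg, of 2] by simp
    have 2: "(\<phi> \<bar>X \<omega>\<bar>)\<^sup>2 \<le> K\<^sup>2" using K nonneg by (intro power_mono) auto
    show "(\<phi> \<bar>X \<omega>\<bar>)\<^sup>2 \<le> (X \<omega>)\<^sup>2 * indicator {\<omega>. \<bar>X \<omega>\<bar> \<le> K} \<omega> + K\<^sup>2 * indicator {\<omega>\<in>space M. \<bar>X \<omega>\<bar> > L} \<omega>"
      using 1 2 LK \<omega> by (cases "\<bar>X \<omega>\<bar> \<le> K") (auto simp: indicator_def intro: add_increasing2)
  qed
  also have "\<dots> = trunc_moment L K"
    using int1 int2 by (simp add: trunc_moment_def)
  finally show ?thesis using C_nonneg by (simp add: eq mult_left_mono)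
qed

lemma second_moment_g_trunc_le:
  assumes "1 \<le> n" "0 \<le> L" "L \<le> K"
  shows "expectation (\<lambda>\<omega>. (g_trunc L (Xs n \<omega>))\<^sup>2) \<le> C * trunc_moment L K"
proof (rule second_moment_le[where \<phi> = "\<lambda>t. min t L"])
  show "(g_trunc L t)\<^sup>2 = (min \<bar>t\<bar> L)\<^sup>2" for t
    using abs_g_trunc[OF assms(2), of t] by (metis power2_abs)
qed (use assms in \<open>auto simp: mono_on_def intro!: continuous_intros\<close>)

lemma second_moment_h_trunc_le:
  assumes "1 \<le> n" "0 \<le> L" "L \<le> K"
  shows "expectation (\<lambda>\<omega>. (h_trunc L K (Xs n \<omega>))\<^sup>2) \<le> C * trunc_moment L K"
  by (rule second_moment_le[where \<phi> = "\<lambda>t. min t K - min t L"])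
     (use assms in \<open>auto simp: mono_on_def h_trunc_eq intro!: continuous_intros\<close>)

text \<open>Chebyshev for consecutive indices, for a truncation \<open>f\<close> that stands for either \<open>g\<close> or \<open>h\<close>.\<close>

lemma block_tail:
  assumes [measurable]: "f \<in> borel_measurable borel" and bd: "\<And>x. \<bar>f x\<bar> \<le> K"
    and mom: "\<And>i. 1 \<le> i \<Longrightarrow> expectation (\<lambda>\<omega>. (f (Xs i \<omega>))\<^sup>2) \<le> D" and t: "0 < t"
  shows "\<P>(\<omega> in M. \<bar>\<Sum>i\<in>{p<..p+N}. f (Xs i \<omega>) - expectation (\<lambda>\<omega>. f (Xs i \<omega>))\<bar> > t)
    \<le> (real N * D + 2 * max 0 (\<Sum>(i, j) | 1 + p \<le> i \<and> i < j \<and> j \<le> p + N.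
          covariance M (\<lambda>\<omega>. f (Xs i \<omega>)) (\<lambda>\<omega>. f (Xs j \<omega>)))) / t\<^sup>2"
proof -
  have pairs: "{(i, j). i \<in> {p<..p+N} \<and> j \<in> {p<..p+N} \<and> i < j} = {(i, j). 1 + p \<le> i \<and> i < j \<and> j \<le> p + N}"
    by auto
  have "(\<Sum>i\<in>{p<..p+N}. expectation (\<lambda>\<omega>. (f (Xs i \<omega>))\<^sup>2)) \<le> (\<Sum>i\<in>{p<..p+N}. D)"
    by (intro sum_mono mom) auto
  then have sum: "(\<Sum>i\<in>{p<..p+N}. expectation (\<lambda>\<omega>. (f (Xs i \<omega>))\<^sup>2)) \<le> real N * D"
    by simp
  have rv: "(\<lambda>\<omega>. f (Xs i \<omega>)) \<in> borel_measurable M" if "i \<in> {p<..p+N}" for i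
  proof -
    have [measurable]: "Xs i \<in> borel_measurable M" using that by (intro Xs_rv) auto
    show ?thesis by measurable
  qed
  show ?thesis
    by (rule order_trans[OF prob_centered_sum_gt_le[OF _ rv bd t]])
       (simp_all only: pairs divide_right_mono add_right_mono sum zero_le_power2 finite_greaterThanAtMost)
qed

end

section \<open>The maximal inequality on one geometric block\<close>

lemma (in finite_measure) measure_UN_bound:
  assumes "finite I" "\<And>i. i \<in> I \<Longrightarrow> A i \<in> sets M" "\<And>i. i \<in> I \<Longrightarrow> measure M (A i) \<le> f i"
  shows "measure M (\<Union>i\<in>I. A i) \<le> (\<Sum>i\<in>I. f i)"
  using assms by (intro order_trans[OF measure_UNION_le] sum_mono) auto

context dominated_sequence
begin

text \<open>One geometric block of indices. The bad event consists of three parts: some variable exceeds the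
  highest truncation level; some digit block of the centred truncations exceeds its threshold; some full
  block of the increments \<open>h\<close> exceeds its threshold after centring. Off these events the chaining bound
  applies at the highest level, which coincides there with the untruncated sum. The increments enter
  chaining through \<open>h + E h\<close>, so \<open>2 E h\<close> has to be added to their centred sum; each of these means, and the change of
  the final centring, is a tail mean of \<open>X\<close>, which accounts for the constant \<open>3 = 2 + 1\<close>. The probabilities
  of the last two parts come from the Chebyshev bound: at level \<open>k\<close> there are \<open>r\<^sup>m\<^sup>+\<^sup>1\<^sup>-\<^sup>k\<close> blocks of length at
  most \<open>r\<^sup>k\<close>, whence the factor \<open>r\<^sup>m\<^sup>+\<^sup>1\<close>, and \<open>r - 1\<close> possible digits.\<close>

lemma maximal_inequality:
  fixes B t :: "nat \<Rightarrow> real" and r m :: nat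
  assumes r: "1 < r" and B_pos: "\<And>k. 0 < B k" and B_mono: "\<And>k. B k \<le> B (Suc k)"
    and t_pos: "\<And>k. k \<in> {1..m+1} \<Longrightarrow> 0 < t k"
  defines "F \<equiv> \<lambda>k. MAX l\<in>{1..r-1}. \<Sum>h = 0..r ^ (m + 1 - k) - 1.
           max 0 (\<Sum>(i, j) | 1 + h * r ^ k \<le> i \<and> i < j \<and> j \<le> h * r ^ k + l * r ^ (k - 1).
             G_cov M (Xs i) (Xs j) (B (k - 1)))"
    and "H \<equiv> \<lambda>k. \<Sum>h = 0..r ^ (m + 1 - k) - 1.
           max 0 (\<Sum>(i, j) | 1 + h * r ^ k \<le> i \<and> i < j \<and> j \<le> h * r ^ k + r ^ k.
             H_cov M (Xs i) (Xs j) (B (k - 1)) (B k))"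
    and "D \<equiv> \<lambda>k. C * trunc_moment (B (k - 1)) (B k)"
  shows "\<P>(\<omega> in M. \<exists>j\<in>{1..<r ^ (m + 1)}. \<bar>\<Sum>k=1..j. Xs k \<omega> - expectation (Xs k)\<bar>
      > 2 * (\<Sum>k=1..m+1. t k) + 3 * C * (\<Sum>k=1..m+1. real r ^ k * tail_mean (B (k - 1))))
    \<le> C * real r ^ (m + 1) * \<P>(\<omega> in M. \<bar>X \<omega>\<bar> > B (m + 1))
      + (\<Sum>k=1..m+1. (real r * real r ^ (m + 1) * D k + 2 * real r * F k + 2 * H k) / (t k)\<^sup>2)"
proof -
  let ?N = "r ^ (m + 1)"
  let ?g = "\<lambda>k i \<omega>. g_trunc (B k) (Xs i \<omega>) - expectation (\<lambda>\<omega>. g_trunc (B k) (Xs i \<omega>))"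
  let ?h = "\<lambda>k i \<omega>. h_trunc (B (k - 1)) (B k) (Xs i \<omega>)"
  let ?p = "\<lambda>k h. h * r ^ k"
  define E1 where "E1 i = {\<omega>\<in>space M. \<bar>Xs i \<omega>\<bar> > B (m + 1)}" for i
  define E2 where "E2 k l h = {\<omega>\<in>space M. \<bar>\<Sum>i\<in>{?p k h<..?p k h + l * r ^ (k - 1)}. ?g (k - 1) i \<omega>\<bar> > t k}" for k l h
  define E3 where "E3 k h = {\<omega>\<in>space M. \<bar>\<Sum>i\<in>{?p k h<..?p k h + r ^ k}. ?h k i \<omega> - expectation (?h k i)\<bar> > t k}" for k h
  define K where "K = {1..m+1}"
  define hs where "hs k = {0..r ^ (m + 1 - k) - 1}" for k
  define bad1 where "bad1 = (\<Union>i\<in>{1..?N}. E1 i)"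
  define bad2 where "bad2 k = (\<Union>l\<in>{1..r-1}. \<Union>h\<in>hs k. E2 k l h)" for k
  define bad3 where "bad3 k = (\<Union>h\<in>hs k. E3 k h)" for k
  have hs_iff: "h \<in> hs k \<longleftrightarrow> h < r ^ (m + 1 - k)" for h k
  proof -
    have "0 < r ^ (m + 1 - k)" using r by simp
    then obtain q where "r ^ (m + 1 - k) = Suc q" using gr0_implies_Suc by blast
    then show ?thesis by (simp add: hs_def less_Suc_eq_le)
  qed
  have card_hs: "card (hs k) = r ^ (m + 1 - k)" for k
    using r by (simp add: hs_def)
  have B_mono': "B (k - 1) \<le> B k" for k using B_mono[of "k - 1"] by (cases k) auto
  have B0: "0 \<le> B k" for k using B_pos[of k] by simp
  have E1_sets [measurable]: "E1 i \<in> sets M" if "1 \<le> i" for i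
    using Xs_rv[OF that] unfolding E1_def by measurable
  have g_rv: "?g k i \<in> borel_measurable M" if "1 \<le> i" for k i
    using Xs_rv[OF that] by measurable
  have h_rv: "?h k i \<in> borel_measurable M" if "1 \<le> i" for k i
    using Xs_rv[OF that] by measurable
  have E2_sets [measurable]: "E2 k l h \<in> sets M" for k l h
  proof -
    have [measurable]: "(\<lambda>\<omega>. \<Sum>i\<in>{?p k h<..?p k h + l * r ^ (k - 1)}. ?g (k - 1) i \<omega>) \<in> borel_measurable M"
      by (intro borel_measurable_sum g_rv) auto
    show ?thesis unfolding E2_def by measurable
  qed
  have E3_sets [measurable]: "E3 k h \<in> sets M" for k h
  proof -
    have [measurable]: "(\<lambda>\<omega>. \<Sum>i\<in>{?p k h<..?p k h + r ^ k}. ?h k i \<omega> - expectation (?h k i)) \<in> borel_measurable M"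
      by (intro borel_measurable_sum borel_measurable_diff borel_measurable_const h_rv) auto
    show ?thesis unfolding E3_def by measurable
  qed
  have bad1_sets: "bad1 \<in> sets M" unfolding bad1_def by (intro sets.finite_UN) auto
  have bad2_sets: "bad2 k \<in> sets M" for k
    unfolding bad2_def hs_def by (intro sets.finite_UN) auto
  have bad3_sets: "bad3 k \<in> sets M" for k
    unfolding bad3_def hs_def by (intro sets.finite_UN) auto

  have P1: "measure M bad1 \<le> C * real r ^ (m + 1) * \<P>(\<omega> in M. \<bar>X \<omega>\<bar> > B (m + 1))"
  proof -
    have "measure M bad1 \<le> (\<Sum>i\<in>{1..?N}. C * \<P>(\<omega> in M. \<bar>X \<omega>\<bar> > B (m + 1)))"
      unfolding bad1_def by (rule measure_UN_bound) (use E1_sets in \<open>auto simp: E1_def intro: tail B_pos\<close>)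
    then show ?thesis by (simp add: mult_ac)
  qed

  have count: "real (card (hs k)) * (real (r ^ k) * d) = real r ^ (m + 1) * d" if "k \<in> K" for k d
    using that unfolding K_def card_hs by (simp flip: power_add mult.assoc)
  have D_nonneg: "0 \<le> D k" for k
    unfolding D_def using C_nonneg trunc_moment_nonneg by simp

  have P2: "measure M (bad2 k) \<le> ((real r - 1) * (real r ^ (m + 1) * D k) + 2 * real r * F k) / (t k)\<^sup>2"
    if k: "k \<in> K" for k
  proof -
    define f where "f l h = max 0 (\<Sum>(i, j) | 1 + h * r ^ k \<le> i \<and> i < j \<and> j \<le> h * r ^ k + l * r ^ (k - 1).
             G_cov M (Xs i) (Xs j) (B (k - 1)))" for l h
    have "F k = (MAX l\<in>{1..r-1}. \<Sum>h\<in>hs k. f l h)"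
      by (simp add: F_def f_def hs_def)
    then have F: "(\<Sum>h\<in>hs k. f l h) \<le> F k" if "l \<in> {1..r-1}" for l
      using that by simp
    have "0 \<le> (\<Sum>h\<in>hs k. f 1 h)" by (intro sum_nonneg) (simp add: f_def)
    moreover have "1 \<in> {1..r-1}" using r by auto
    ultimately have F0: "0 \<le> F k" using F by (meson order_trans)
    have E2: "measure M (E2 k l h) \<le> (real (r ^ k) * D k + 2 * f l h) / (t k)\<^sup>2" if "l \<in> {1..r-1}" for l h
    proof -
      have "measure M (E2 k l h) \<le> (real (l * r ^ (k - 1)) * D k + 2 * f l h) / (t k)\<^sup>2"
        unfolding E2_def f_def G_cov_def D_def using k B0 B_mono' t_pos
        by (intro block_tail[where K = "B (k - 1)"] second_moment_g_trunc_le)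
           (auto simp: abs_g_trunc K_def)
      also have "\<dots> \<le> (real (r ^ k) * D k + 2 * f l h) / (t k)\<^sup>2"
      proof -
        \<comment> \<open>A digit block is part of the full block around it.\<close>
        have "l * r ^ (k - 1) \<le> r * r ^ (k - 1)" using that by (intro mult_right_mono) auto
        also have "\<dots> = r ^ k" using k by (cases k) (auto simp: K_def)
        finally have "real (l * r ^ (k - 1)) \<le> real (r ^ k)" by (simp only: of_nat_le_iff)
        then show ?thesis
          by (intro divide_right_mono add_right_mono mult_right_mono D_nonneg) auto
      qed
      finally show ?thesis .
    qed
    have "measure M (\<Union>h\<in>hs k. E2 k l h) \<le> (real r ^ (m + 1) * D k + 2 * F k) / (t k)\<^sup>2"
      if l: "l \<in> {1..r-1}" for l
    proof -
      have "measure M (\<Union>h\<in>hs k. E2 k l h) \<le> (\<Sum>h\<in>hs k. (real (r ^ k) * D k + 2 * f l h) / (t k)\<^sup>2)"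
        using E2[OF l] by (intro measure_UN_bound) (auto simp: hs_def)
      also have "\<dots> = (real (card (hs k)) * (real (r ^ k) * D k) + 2 * (\<Sum>h\<in>hs k. f l h)) / (t k)\<^sup>2"
        by (simp add: sum.distrib sum_distrib_left flip: sum_divide_distrib)
      also have "\<dots> \<le> (real r ^ (m + 1) * D k + 2 * F k) / (t k)\<^sup>2"
        using F[OF l] unfolding count[OF k] by (intro divide_right_mono) auto
      finally show ?thesis .
    qed
    then have "measure M (bad2 k) \<le> (\<Sum>l\<in>{1..r-1}. (real r ^ (m + 1) * D k + 2 * F k) / (t k)\<^sup>2)"
      unfolding bad2_def by (intro measure_UN_bound sets.finite_UN) (auto simp: hs_def)
    also have "\<dots> = ((real r - 1) * (real r ^ (m + 1) * D k) + 2 * (real r - 1) * F k) / (t k)\<^sup>2"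
      using r by (simp add: algebra_simps add_divide_distrib diff_divide_distrib of_nat_diff)
    also have "\<dots> \<le> ((real r - 1) * (real r ^ (m + 1) * D k) + 2 * real r * F k) / (t k)\<^sup>2"
      using F0 by (intro divide_right_mono add_left_mono mult_right_mono) auto
    finally show ?thesis .
  qed

  have P3: "measure M (bad3 k) \<le> (real r ^ (m + 1) * D k + 2 * H k) / (t k)\<^sup>2" if k: "k \<in> K" for k
  proof -
    define f where "f h = max 0 (\<Sum>(i, j) | 1 + h * r ^ k \<le> i \<and> i < j \<and> j \<le> h * r ^ k + r ^ k.
             H_cov M (Xs i) (Xs j) (B (k - 1)) (B k))" for h
    have "measure M (E3 k h) \<le> (real (r ^ k) * D k + 2 * f h) / (t k)\<^sup>2" for h
    proof -
      have "\<bar>h_trunc (B (k - 1)) (B k) x\<bar> \<le> B k" for x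
        using B0[of "k - 1"] B_mono'[of k] by (auto simp: h_trunc_eq)
      then show ?thesis
        unfolding E3_def f_def H_cov_def D_def using k B0 B_mono' t_pos
        by (intro block_tail second_moment_h_trunc_le) (auto simp: K_def)
    qed
    then have "measure M (bad3 k) \<le> (\<Sum>h\<in>hs k. (real (r ^ k) * D k + 2 * f h) / (t k)\<^sup>2)"
      unfolding bad3_def by (intro measure_UN_bound) (auto simp: hs_def)
    also have "\<dots> = (real (card (hs k)) * (real (r ^ k) * D k) + 2 * (\<Sum>h\<in>hs k. f h)) / (t k)\<^sup>2"
      by (simp add: sum.distrib sum_distrib_left flip: sum_divide_distrib)
    also have "\<dots> = (real r ^ (m + 1) * D k + 2 * H k) / (t k)\<^sup>2"
      unfolding count[OF k] by (simp add: H_def f_def hs_def)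
    finally show ?thesis .
  qed

  define R where "R = (\<Sum>k\<in>K. real r ^ k * tail_mean (B (k - 1)))"
  have R_term: "real r ^ k * tail_mean (B (k - 1)) \<le> R" if "k \<in> K" for k
    unfolding R_def using that by (intro member_le_sum) (auto simp: K_def tail_mean_nonneg)
  have good: "\<bar>\<Sum>k=1..j. Xs k \<omega> - expectation (Xs k)\<bar> \<le> 2 * (\<Sum>k\<in>K. t k) + 3 * C * R"
    if \<omega>: "\<omega> \<in> space M" "\<omega> \<notin> bad1" "\<omega> \<notin> (\<Union>k\<in>K. bad2 k \<union> bad3 k)" and j: "j < ?N" for \<omega> j
  proof -
    \<comment> \<open>Outside the first bad event the highest truncation has no effect.\<close>
    have trunc: "Xs i \<omega> = g_trunc (B (m + 1)) (Xs i \<omega>)" if "i \<in> {1..j}" for i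
    proof -
      have "i \<in> {1..?N}" using that j by auto
      then have "\<bar>Xs i \<omega>\<bar> \<le> B (m + 1)" using \<omega> by (force simp: bad1_def E1_def)
      then show ?thesis by (auto simp: g_trunc_def)
    qed
    have "\<bar>\<Sum>i=1..j. ?g (Suc m) i \<omega>\<bar> \<le> (\<Sum>k=1..Suc m. t k + (t k + 2 * (real r ^ k * (C * tail_mean (B (k - 1))))))"
    proof (rule chaining[where z = "\<lambda>k i. ?h k i \<omega> + expectation (?h k i)"])
      fix k i :: nat assume "k \<le> m" "1 \<le> i"
      then have "\<bar>expectation (\<lambda>\<omega>. g_trunc (B (Suc k)) (Xs i \<omega>)) - expectation (\<lambda>\<omega>. g_trunc (B k) (Xs i \<omega>))\<bar>
          = \<bar>expectation (\<lambda>\<omega>. g_trunc (B (Suc k)) (Xs i \<omega>) - g_trunc (B k) (Xs i \<omega>))\<bar>"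
        using B0 by (simp add: g_trunc_Xs_integrable)
      also have "\<dots> \<le> expectation (?h (Suc k) i)"
        unfolding h_trunc_def by (simp add: integral_abs_bound)
      finally show "\<bar>?g (Suc k) i \<omega> - ?g k i \<omega>\<bar> \<le> ?h (Suc k) i \<omega> + expectation (?h (Suc k) i)"
        by (simp add: h_trunc_def)
    next
      fix k assume "k \<le> m" then show "0 \<le> t (Suc k)" using t_pos[of "Suc k"] by simp
    next
      fix k h l assume *: "k \<le> m" "h < r ^ (m - k)" "l \<in> {1..r - 1}"
      then have "\<omega> \<notin> E2 (Suc k) l h"
        using \<omega> by (force simp: bad2_def K_def hs_iff)
      then show "\<bar>\<Sum>i\<in>{?p (Suc k) h<..?p (Suc k) h + l * r ^ k}. ?g k i \<omega>\<bar> \<le> t (Suc k)"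
        using \<omega> by (simp add: E2_def)
    next
      fix k h assume *: "k \<le> m" "h < r ^ (m - k)"
      let ?I = "{?p (Suc k) h<..?p (Suc k) h + r ^ Suc k}"
      have "\<omega> \<notin> E3 (Suc k) h"
        using \<omega> * by (force simp: bad3_def K_def hs_iff)
      then have "(\<Sum>i\<in>?I. ?h (Suc k) i \<omega> - expectation (?h (Suc k) i)) \<le> t (Suc k)"
        using \<omega> by (simp add: E3_def)
      moreover have "(\<Sum>i\<in>?I. expectation (?h (Suc k) i)) \<le> (\<Sum>i\<in>?I. C * tail_mean (B k))"
        using B0 B_mono by (intro sum_mono) (auto intro!: mean_h_trunc_le)
      ultimately show "(\<Sum>i\<in>?I. ?h (Suc k) i \<omega> + expectation (?h (Suc k) i))
          \<le> t (Suc k) + 2 * (real r ^ Suc k * (C * tail_mean (B (Suc k - 1))))"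
        by (simp add: sum.distrib sum_subtractf)
    qed (use j in simp)
    also have "\<dots> = 2 * (\<Sum>k\<in>K. t k) + 2 * C * R"
      by (simp add: K_def R_def sum.distrib sum_distrib_left mult_ac del: sum.cl_ivl_Suc)
    finally have 1: "\<bar>\<Sum>i=1..j. ?g (Suc m) i \<omega>\<bar> \<le> 2 * (\<Sum>k\<in>K. t k) + 2 * C * R" .
    have "\<bar>\<Sum>i=1..j. expectation (\<lambda>\<omega>. g_trunc (B (m + 1)) (Xs i \<omega>)) - expectation (Xs i)\<bar>
        \<le> (\<Sum>i=1..j. C * tail_mean (B m))"
    proof (intro order_trans[OF sum_abs] sum_mono)
      fix i assume "i \<in> {1..j}"
      then have "\<bar>expectation (\<lambda>\<omega>. g_trunc (B (m + 1)) (Xs i \<omega>)) - expectation (Xs i)\<bar> \<le> C * tail_mean (B (m + 1))"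
        using mean_g_trunc_diff_le[of i "B (m + 1)"] B0 by (simp add: abs_minus_commute)
      \<comment> \<open>The last term of \<open>R\<close> has the factor \<open>r\<^sup>m\<^sup>+\<^sup>1\<close> but the tail mean beyond level \<open>m\<close>.\<close>
      also have "tail_mean (B (m + 1)) \<le> tail_mean (B m)"
        unfolding tail_mean_def using B_mono[of m]
        by (intro integral_mono tail_mean_integrable) (auto simp: indicator_def)
      finally show "\<bar>expectation (\<lambda>\<omega>. g_trunc (B (m + 1)) (Xs i \<omega>)) - expectation (Xs i)\<bar> \<le> C * tail_mean (B m)"
        using C_nonneg by (simp add: mult_left_mono)
    qed
    also have "\<dots> = real j * (C * tail_mean (B m))" by simp
    also have "\<dots> \<le> real ?N * (C * tail_mean (B m))"
      using j C_nonneg tail_mean_nonneg by (intro mult_right_mono) (auto simp del: power_Suc of_nat_power)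
    also have "\<dots> \<le> C * R"
    proof -
      have "real ?N * tail_mean (B m) \<le> R" using R_term[of "m + 1"] by (simp add: K_def)
      from mult_left_mono[OF this C_nonneg] show ?thesis by (simp only: mult.left_commute)
    qed
    finally have 2: "\<bar>\<Sum>i=1..j. expectation (\<lambda>\<omega>. g_trunc (B (m + 1)) (Xs i \<omega>)) - expectation (Xs i)\<bar> \<le> C * R" .
    have "(\<Sum>i=1..j. Xs i \<omega> - expectation (Xs i))
        = (\<Sum>i=1..j. ?g (Suc m) i \<omega> + (expectation (\<lambda>\<omega>. g_trunc (B (m + 1)) (Xs i \<omega>)) - expectation (Xs i)))"
      using trunc by (intro sum.cong) auto
    also have "\<dots> = (\<Sum>i=1..j. ?g (Suc m) i \<omega>)
        + (\<Sum>i=1..j. expectation (\<lambda>\<omega>. g_trunc (B (m + 1)) (Xs i \<omega>)) - expectation (Xs i))"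
      by (rule sum.distrib)
    finally show ?thesis using 1 2 by (simp add: algebra_simps)
  qed

  have "\<P>(\<omega> in M. \<exists>j\<in>{1..<?N}. \<bar>\<Sum>k=1..j. Xs k \<omega> - expectation (Xs k)\<bar> > 2 * (\<Sum>k\<in>K. t k) + 3 * C * R)
      \<le> measure M (bad1 \<union> (\<Union>k\<in>K. bad2 k \<union> bad3 k))"
  proof (intro finite_measure_mono subsetI)
    fix \<omega> assume "\<omega> \<in> {\<omega> \<in> space M. \<exists>j\<in>{1..<?N}. \<bar>\<Sum>k=1..j. Xs k \<omega> - expectation (Xs k)\<bar>
        > 2 * (\<Sum>k\<in>K. t k) + 3 * C * R}"
    then obtain j where "\<omega> \<in> space M" "j < ?N"
        "\<bar>\<Sum>k=1..j. Xs k \<omega> - expectation (Xs k)\<bar> > 2 * (\<Sum>k\<in>K. t k) + 3 * C * R"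
      by force
    then show "\<omega> \<in> bad1 \<union> (\<Union>k\<in>K. bad2 k \<union> bad3 k)"
      using good[of \<omega> j] by (meson UnI1 UnI2 not_le)
  next
    show "bad1 \<union> (\<Union>k\<in>K. bad2 k \<union> bad3 k) \<in> sets M"
      using bad1_sets bad2_sets bad3_sets by (intro sets.Un sets.finite_UN) (auto simp: K_def)
  qed
  also have "\<dots> \<le> measure M bad1 + measure M (\<Union>k\<in>K. bad2 k \<union> bad3 k)"
    using bad1_sets bad2_sets bad3_sets
    by (intro measure_subadditive sets.Un sets.finite_UN) (auto simp: K_def)
  also have "measure M (\<Union>k\<in>K. bad2 k \<union> bad3 k)
      \<le> (\<Sum>k\<in>K. (real r * real r ^ (m + 1) * D k + 2 * real r * F k + 2 * H k) / (t k)\<^sup>2)"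
  proof (rule measure_UN_bound)
    fix k assume k: "k \<in> K"
    have "measure M (bad2 k \<union> bad3 k) \<le> measure M (bad2 k) + measure M (bad3 k)"
      by (intro measure_subadditive bad2_sets bad3_sets) auto
    also have "\<dots> \<le> ((real r - 1) * (real r ^ (m + 1) * D k) + 2 * real r * F k) / (t k)\<^sup>2
        + (real r ^ (m + 1) * D k + 2 * H k) / (t k)\<^sup>2"
      by (intro add_mono P2 P3 k)
    also have "\<dots> = (real r * real r ^ (m + 1) * D k + 2 * real r * F k + 2 * H k) / (t k)\<^sup>2"
      by (simp add: algebra_simps flip: add_divide_distrib)
    finally show "measure M (bad2 k \<union> bad3 k) \<le> \<dots>" .
  qed (auto simp: K_def bad2_sets bad3_sets)
  finally show ?thesis
    using P1 by (simp add: K_def R_def)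
qed

end

section \<open>Summability of the weighted probabilities\<close>

theorem theorem2:
  fixes M :: "'a measure" and Xs :: "nat \<Rightarrow> 'a \<Rightarrow> real" and X :: "'a \<Rightarrow> real"
    and r :: nat and b c :: "nat \<Rightarrow> real" and a :: "nat \<Rightarrow> nat \<Rightarrow> real"
  assumes M: "prob_space M"
    and r: "r > 1"
    and Xs_rv: "\<And>n. n \<ge> 1 \<Longrightarrow> Xs n \<in> borel_measurable M"
    and X_rv: "X \<in> borel_measurable M"
    and dom: "stoch_dominated M Xs X"
    and X_int: "integrable M (\<lambda>\<omega>. \<bar>X \<omega>\<bar>)"
    and b_pos: "\<And>n. n \<ge> 1 \<Longrightarrow> b n > 0"
    and b_mono: "mono_on {1..} b"
    and c_nonneg: "\<And>n. n \<ge> 1 \<Longrightarrow> c n \<ge> 0"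
    and c_antimono: "antimono_on {1..} c"
    and a_pos: "\<And>n k. 1 \<le> k \<Longrightarrow> k \<le> n + 1 \<Longrightarrow> a n k > 0"
    and cond_a: "(\<lambda>n. \<Sum>k=1..n+1. a n k) \<in> O(\<lambda>n. b (r ^ n))"
    and cond_b': "(\<lambda>n. \<Sum>k=1..n+1. real r ^ k *
        (\<integral>\<omega>. \<bar>X \<omega>\<bar> * indicator {\<omega>. \<bar>X \<omega>\<bar> > b (r ^ (k - 1))} \<omega> \<partial>M)) \<in> o(\<lambda>n. b (r ^ n))"
    and cond_c: "summable (\<lambda>m. \<Sum>n = r ^ m..r ^ (m + 1) - 1.
        real r ^ m * c n * \<P>(\<omega> in M. \<bar>X \<omega>\<bar> > b (r ^ (m + 1))))"
    and cond_d: "summable (\<lambda>m. \<Sum>n = r ^ m..r ^ (m + 1) - 1. \<Sum>k=1..m+1.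
        c n * real r ^ m / (a m k)\<^sup>2 *
        (\<integral>\<omega>. (X \<omega>)\<^sup>2 * indicator {\<omega>. \<bar>X \<omega>\<bar> \<le> b (r ^ k)} \<omega> \<partial>M))"
    and cond_e: "summable (\<lambda>m. \<Sum>n = r ^ m..r ^ (m + 1) - 1. \<Sum>k=1..m+1.
        c n * real r ^ m * (b (r ^ k))\<^sup>2 / (a m k)\<^sup>2 *
        \<P>(\<omega> in M. \<bar>X \<omega>\<bar> > b (r ^ (k - 1))))"
    and cond_f: "summable (\<lambda>m. \<Sum>n = r ^ m..r ^ (m + 1) - 1. \<Sum>k=1..m+1.
        c n / (a m k)\<^sup>2 *
        (MAX l\<in>{1..r-1}. \<Sum>h = 0..r ^ (m + 1 - k) - 1.
           max 0 (\<Sum>(i, j) | 1 + h * r ^ k \<le> i \<and> i < j \<and> j \<le> h * r ^ k + l * r ^ (k - 1).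
             G_cov M (Xs i) (Xs j) (b (r ^ (k - 1))))))"
    and cond_g: "summable (\<lambda>m. \<Sum>n = r ^ m..r ^ (m + 1) - 1. \<Sum>k=1..m+1.
        c n / (a m k)\<^sup>2 *
        (\<Sum>h = 0..r ^ (m + 1 - k) - 1.
           max 0 (\<Sum>(i, j) | 1 + h * r ^ k \<le> i \<and> i < j \<and> j \<le> h * r ^ k + r ^ k.
             H_cov M (Xs i) (Xs j) (b (r ^ (k - 1))) (b (r ^ k)))))"
  shows "\<forall>\<epsilon>>0. summable (\<lambda>n. c (n + 1) *
      \<P>(\<omega> in M. (MAX j\<in>{1..n+1}. \<bar>\<Sum>k=1..j. (Xs k \<omega> - (\<integral>\<omega>'. Xs k \<omega>' \<partial>M))\<bar>)
        > \<epsilon> * b (n + 1)))"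
proof (intro allI impI)
  fix \<epsilon> :: real assume \<epsilon>: "0 < \<epsilon>"
  interpret prob_space M by (rule M)
  obtain C where C: "0 < C" and sup_le: "\<And>t. 0 < t \<Longrightarrow>
      (SUP n\<in>{1..}. \<P>(\<omega> in M. \<bar>Xs n \<omega>\<bar> > t)) \<le> C * \<P>(\<omega> in M. \<bar>X \<omega>\<bar> > t)"
    using dom unfolding stoch_dominated_def by blast
  interpret dominated_sequence M Xs X C
  proof
    show "\<P>(\<omega> in M. \<bar>Xs n \<omega>\<bar> > t) \<le> C * \<P>(\<omega> in M. \<bar>X \<omega>\<bar> > t)" if "1 \<le> n" "0 < t" for n t
      using that by (intro order_trans[OF cSUP_upper sup_le]) (auto intro!: bdd_aboveI[of _ 1])
  qed (use C Xs_rv X_rv X_int in auto)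

  define B where "B k = b (r ^ k)" for k
  have pow_pos: "1 \<le> r ^ k" for k using r by simp
  have B_pos: "0 < B k" for k unfolding B_def using b_pos pow_pos by blast
  have B_mono: "B k \<le> B (Suc k)" for k
  proof -
    have "r ^ k \<le> r ^ Suc k" using r by (intro power_increasing) auto
    then show ?thesis
      unfolding B_def using pow_pos by (intro mono_onD[OF b_mono]) (simp_all only: atLeast_iff)
  qed

  define R where "R m = (\<Sum>k=1..m+1. real r ^ k * tail_mean (B (k - 1)))" for m
  define p where "p m = \<P>(\<omega> in M. \<bar>X \<omega>\<bar> > B (m + 1))" for m
  define d where "d k = (\<integral>\<omega>. (X \<omega>)\<^sup>2 * indicator {\<omega>. \<bar>X \<omega>\<bar> \<le> B k} \<omega> \<partial>M)" for k
  define e where "e k = (B k)\<^sup>2 * \<P>(\<omega> in M. \<bar>X \<omega>\<bar> > B (k - 1))" for k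
  define F where "F m k = (MAX l\<in>{1..r-1}. \<Sum>h = 0..r ^ (m + 1 - k) - 1.
           max 0 (\<Sum>(i, j) | 1 + h * r ^ k \<le> i \<and> i < j \<and> j \<le> h * r ^ k + l * r ^ (k - 1).
             G_cov M (Xs i) (Xs j) (B (k - 1))))" for m k
  define H where "H m k = (\<Sum>h = 0..r ^ (m + 1 - k) - 1.
           max 0 (\<Sum>(i, j) | 1 + h * r ^ k \<le> i \<and> i < j \<and> j \<le> h * r ^ k + r ^ k.
             H_cov M (Xs i) (Xs j) (B (k - 1)) (B k)))" for m k
  have F_nonneg: "0 \<le> F m k" for m k
  proof -
    define f where "f l = (\<Sum>h = 0..r ^ (m + 1 - k) - 1.
           max 0 (\<Sum>(i, j) | 1 + h * r ^ k \<le> i \<and> i < j \<and> j \<le> h * r ^ k + l * r ^ (k - 1).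
             G_cov M (Xs i) (Xs j) (B (k - 1))))" for l
    have "0 \<le> f 1" unfolding f_def by (intro sum_nonneg) auto
    also have "f 1 \<le> (MAX l\<in>{1..r-1}. f l)" using r by (intro Max_ge) auto
    finally show ?thesis by (simp only: F_def f_def)
  qed
  have H_nonneg: "0 \<le> H m k" for m k unfolding H_def by (intro sum_nonneg) auto
  have d_nonneg: "0 \<le> d k" for k unfolding d_def by (intro integral_nonneg_AE) auto
  have e_nonneg: "0 \<le> e k" for k unfolding e_def by simp
  have p_nonneg: "0 \<le> p m" for m unfolding p_def by simp

  obtain A where A: "0 < A" and ev_a: "\<forall>\<^sub>F m in sequentially. norm (\<Sum>k=1..m+1. a m k) \<le> A * norm (B m)"
    using cond_a unfolding B_def by (elim landau_o.bigE)
  \<comment> \<open>The thresholds are \<open>\<delta> a\<^sub>m\<^sub>,\<^sub>k\<close>. They occur twice, so with this choice they use up half of \<open>\<epsilon> b\<close>;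
    the tail means may use the other half, whence \<open>\<epsilon> / (6 C)\<close> below.\<close>
  define \<delta> where "\<delta> = \<epsilon> / (4 * A)"
  have \<delta>: "0 < \<delta>" using A \<epsilon> by (simp add: \<delta>_def)
  have "R \<in> o(B)"
    using cond_b' unfolding R_def[abs_def] B_def tail_mean_def .
  then have "\<forall>\<^sub>F m in sequentially. norm (R m) \<le> (\<epsilon> / (6 * C)) * norm (B m)"
    using \<epsilon> C by (intro landau_o.smallD) auto
  with ev_a have "\<forall>\<^sub>F m in sequentially. 2 * (\<Sum>k=1..m+1. \<delta> * a m k) + 3 * C * R m \<le> \<epsilon> * B m"
  proof eventually_elim
    case (elim m)
    have "(\<Sum>k=1..m+1. \<delta> * a m k) = \<delta> * (\<Sum>k=1..m+1. a m k)" by (rule sum_distrib_left[symmetric])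
    also have "\<dots> \<le> \<delta> * (A * B m)"
      using elim(1) B_pos[of m] \<delta> by (intro mult_left_mono) auto
    also have "\<dots> = \<epsilon> / 4 * B m" using A by (simp add: \<delta>_def)
    finally have 1: "(\<Sum>k=1..m+1. \<delta> * a m k) \<le> \<epsilon> / 4 * B m" .
    have "C * R m \<le> C * ((\<epsilon> / (6 * C)) * B m)"
      using elim(2) B_pos[of m] C by (intro mult_left_mono) auto
    also have "\<dots> = \<epsilon> / 6 * B m" using C by simp
    finally have 2: "C * R m \<le> \<epsilon> / 6 * B m" .
    show ?case using 1 2 by simp
  qed
  then obtain m0 where m0: "\<And>m. m0 \<le> m \<Longrightarrow> 2 * (\<Sum>k=1..m+1. \<delta> * a m k) + 3 * C * R m \<le> \<epsilon> * B m"
    by (auto simp: eventually_sequentially)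

  \<comment> \<open>Up to a constant this is the bound of the maximal inequality, arranged so that its weighted sum over
    a block is literally the sum of the terms of the five given series.\<close>
  define Q where "Q m = real r ^ m * p m + (\<Sum>k=1..m+1. (real r ^ m * d k + real r ^ m * e k + F m k + H m k) / (a m k)\<^sup>2)" for m
  define K1 where "K1 = real r * real r * C + 2 * real r + 2"
  define K2 where "K2 = C * real r + K1 / \<delta>\<^sup>2"
  have K1: "real r * real r * C \<le> K1" "2 * real r \<le> K1" "2 \<le> K1" "0 \<le> K1"
    using C by (simp_all add: K1_def)
  define u where "u n = c n * \<P>(\<omega> in M. (MAX j\<in>{1..n}. \<bar>\<Sum>k=1..j. (Xs k \<omega> - (\<integral>\<omega>'. Xs k \<omega>' \<partial>M))\<bar>) > \<epsilon> * b n)" for n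
  have prob_le: "\<P>(\<omega> in M. (MAX j\<in>{1..n}. \<bar>\<Sum>k=1..j. (Xs k \<omega> - (\<integral>\<omega>'. Xs k \<omega>' \<partial>M))\<bar>) > \<epsilon> * b n) \<le> K2 * Q m"
    if m: "m0 \<le> m" and n: "n \<in> {r ^ m..r ^ (m + 1) - 1}" for m n
  proof -
    have n': "1 \<le> n" "n < r ^ (m + 1)"
      using n pow_pos[of m] pow_pos[of "m + 1"] by (simp_all only: atLeastAtMost_iff) linarith+
    \<comment> \<open>The whole block is handled by one event, because \<open>b\<close> is nondecreasing and \<open>n < r\<^sup>m\<^sup>+\<^sup>1\<close>.\<close>
    have Bn: "B m \<le> b n"
      unfolding B_def using n n' pow_pos[of m] by (intro mono_onD[OF b_mono]) auto
    have level: "2 * (\<Sum>k=1..m+1. \<delta> * a m k) + 3 * C * R m \<le> \<epsilon> * b n"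
      using m0[OF m] Bn \<epsilon> by (meson mult_left_mono less_imp_le order_trans)
    have "{\<omega> \<in> space M. (MAX j\<in>{1..n}. \<bar>\<Sum>k=1..j. (Xs k \<omega> - (\<integral>\<omega>'. Xs k \<omega>' \<partial>M))\<bar>) > \<epsilon> * b n}
      \<subseteq> {\<omega> \<in> space M. \<exists>j\<in>{1..<r ^ (m + 1)}. \<bar>\<Sum>k=1..j. Xs k \<omega> - expectation (Xs k)\<bar>
          > 2 * (\<Sum>k=1..m+1. \<delta> * a m k) + 3 * C * R m}" (is "_ \<subseteq> ?bad")
    proof (intro Collect_mono conjI impI; elim conjE)
      fix \<omega> assume "(MAX j\<in>{1..n}. \<bar>\<Sum>k=1..j. (Xs k \<omega> - (\<integral>\<omega>'. Xs k \<omega>' \<partial>M))\<bar>) > \<epsilon> * b n"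
      then obtain j where "j \<in> {1..n}" "\<bar>\<Sum>k=1..j. (Xs k \<omega> - (\<integral>\<omega>'. Xs k \<omega>' \<partial>M))\<bar> > \<epsilon> * b n"
        using n' by (subst (asm) Max_gr_iff) auto
      then show "\<exists>j\<in>{1..<r ^ (m + 1)}. \<bar>\<Sum>k=1..j. Xs k \<omega> - expectation (Xs k)\<bar>
          > 2 * (\<Sum>k=1..m+1. \<delta> * a m k) + 3 * C * R m"
        using n' level by (intro bexI[of _ j]) auto
    qed
    moreover have "?bad \<in> sets M"
    proof -
      have [measurable]: "(\<lambda>\<omega>. \<Sum>k=1..j. Xs k \<omega> - expectation (Xs k)) \<in> borel_measurable M" for j
        by (intro borel_measurable_sum borel_measurable_diff borel_measurable_const Xs_rv) auto
      show ?thesis by measurable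
    qed
    ultimately have "\<P>(\<omega> in M. (MAX j\<in>{1..n}. \<bar>\<Sum>k=1..j. (Xs k \<omega> - (\<integral>\<omega>'. Xs k \<omega>' \<partial>M))\<bar>) > \<epsilon> * b n)
      \<le> measure M ?bad"
      by (rule finite_measure_mono)
    also have "measure M ?bad \<le> C * real r ^ (m + 1) * p m
      + (\<Sum>k=1..m+1. (real r * real r ^ (m + 1) * (C * (d k + e k)) + 2 * real r * F m k + 2 * H m k) / (\<delta> * a m k)\<^sup>2)"
      unfolding R_def p_def F_def H_def d_def e_def trunc_moment_def[symmetric]
      using r B_pos B_mono \<delta> a_pos by (intro maximal_inequality) auto
    also have "\<dots> \<le> K2 * Q m"
    proof -
      have term_le: "(real r * real r ^ (m + 1) * (C * (d k + e k)) + 2 * real r * F m k + 2 * H m k) / (\<delta> * a m k)\<^sup>2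
        \<le> K1 / \<delta>\<^sup>2 * ((real r ^ m * d k + real r ^ m * e k + F m k + H m k) / (a m k)\<^sup>2)" for k
      proof -
        have "(real r * real r * C) * (real r ^ m * (d k + e k)) \<le> K1 * (real r ^ m * (d k + e k))"
          by (intro mult_right_mono K1 mult_nonneg_nonneg add_nonneg_nonneg d_nonneg e_nonneg) auto
        moreover have "2 * real r * F m k \<le> K1 * F m k" "2 * H m k \<le> K1 * H m k"
          by (intro mult_right_mono K1 F_nonneg H_nonneg)+
        ultimately have "real r * real r ^ (m + 1) * (C * (d k + e k)) + 2 * real r * F m k + 2 * H m k
          \<le> K1 * (real r ^ m * d k + real r ^ m * e k + F m k + H m k)"
          by (simp add: algebra_simps)
        then have "(real r * real r ^ (m + 1) * (C * (d k + e k)) + 2 * real r * F m k + 2 * H m k) / (\<delta> * a m k)\<^sup>2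
          \<le> K1 * (real r ^ m * d k + real r ^ m * e k + F m k + H m k) / (\<delta> * a m k)\<^sup>2"
          by (intro divide_right_mono) auto
        then show ?thesis by (simp add: power_mult_distrib)
      qed
      define S where "S = (\<Sum>k=1..m+1. (real r ^ m * d k + real r ^ m * e k + F m k + H m k) / (a m k)\<^sup>2)"
      have "0 \<le> S" unfolding S_def
        by (intro sum_nonneg divide_nonneg_nonneg add_nonneg_nonneg mult_nonneg_nonneg d_nonneg e_nonneg F_nonneg H_nonneg) auto
      then have 1: "0 \<le> C * real r * S" "0 \<le> K1 / \<delta>\<^sup>2 * (real r ^ m * p m)"
        using C K1(4) p_nonneg[of m] by auto
      have "(\<Sum>k=1..m+1. (real r * real r ^ (m + 1) * (C * (d k + e k)) + 2 * real r * F m k + 2 * H m k) / (\<delta> * a m k)\<^sup>2)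
        \<le> K1 / \<delta>\<^sup>2 * S"
        unfolding S_def sum_distrib_left by (intro sum_mono term_le)
      moreover have "K2 * Q m = C * real r ^ (m + 1) * p m + K1 / \<delta>\<^sup>2 * S + C * real r * S + K1 / \<delta>\<^sup>2 * (real r ^ m * p m)"
        unfolding K2_def Q_def S_def[symmetric] by (simp add: algebra_simps)
      ultimately show ?thesis using 1 by linarith
    qed
    finally show ?thesis .
  qed

  have "summable (\<lambda>m. \<Sum>n=r ^ m..r ^ (m + 1) - 1. u n)"
  proof (rule summable_comparison_test')
    show "summable (\<lambda>m. K2 * (\<Sum>n=r ^ m..r ^ (m + 1) - 1. c n * Q m))"
    proof -
      note parts = summable_add[OF summable_add[OF summable_add[OF summable_add[OF cond_c cond_d] cond_e] cond_f] cond_g]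
      have "(\<Sum>n=r ^ m..r ^ (m + 1) - 1. c n * Q m)
        = (\<Sum>n = r ^ m..r ^ (m + 1) - 1. real r ^ m * c n * p m)
        + (\<Sum>n = r ^ m..r ^ (m + 1) - 1. \<Sum>k=1..m+1. c n * real r ^ m / (a m k)\<^sup>2 * d k)
        + (\<Sum>n = r ^ m..r ^ (m + 1) - 1. \<Sum>k=1..m+1. c n * real r ^ m * (B k)\<^sup>2 / (a m k)\<^sup>2 * \<P>(\<omega> in M. \<bar>X \<omega>\<bar> > B (k - 1)))
        + (\<Sum>n = r ^ m..r ^ (m + 1) - 1. \<Sum>k=1..m+1. c n / (a m k)\<^sup>2 * F m k)
        + (\<Sum>n = r ^ m..r ^ (m + 1) - 1. \<Sum>k=1..m+1. c n / (a m k)\<^sup>2 * H m k)" for m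
        unfolding sum.distrib[symmetric]
      proof (intro sum.cong refl)
        fix n
        have "c n * Q m = real r ^ m * c n * p m
          + (\<Sum>k=1..m+1. c n * ((real r ^ m * d k + real r ^ m * e k + F m k + H m k) / (a m k)\<^sup>2))"
          unfolding Q_def distrib_left sum_distrib_left[symmetric] by simp
        also have "(\<Sum>k=1..m+1. c n * ((real r ^ m * d k + real r ^ m * e k + F m k + H m k) / (a m k)\<^sup>2))
          = (\<Sum>k=1..m+1. c n * real r ^ m / (a m k)\<^sup>2 * d k
            + c n * real r ^ m * (B k)\<^sup>2 / (a m k)\<^sup>2 * \<P>(\<omega> in M. \<bar>X \<omega>\<bar> > B (k - 1))
            + c n / (a m k)\<^sup>2 * F m k + c n / (a m k)\<^sup>2 * H m k)"
          by (intro sum.cong refl) (simp add: e_def add_divide_distrib distrib_left mult_ac)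
        finally show "c n * Q m = real r ^ m * c n * p m
            + (\<Sum>k=1..m+1. c n * real r ^ m / (a m k)\<^sup>2 * d k)
            + (\<Sum>k=1..m+1. c n * real r ^ m * (B k)\<^sup>2 / (a m k)\<^sup>2 * \<P>(\<omega> in M. \<bar>X \<omega>\<bar> > B (k - 1)))
            + (\<Sum>k=1..m+1. c n / (a m k)\<^sup>2 * F m k)
            + (\<Sum>k=1..m+1. c n / (a m k)\<^sup>2 * H m k)"
          by (simp only: sum.distrib add.assoc)
      qed
      then show ?thesis
        using parts unfolding p_def d_def F_def H_def B_def by (intro summable_mult) simp
    qed
  next
    fix m assume m: "m0 \<le> m"
    have n1: "1 \<le> n" if "n \<in> {r ^ m..r ^ (m + 1) - 1}" for n using that pow_pos[of m] by auto
    have "norm (\<Sum>n=r ^ m..r ^ (m + 1) - 1. u n) = (\<Sum>n=r ^ m..r ^ (m + 1) - 1. u n)"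
      using n1 c_nonneg by (simp only: real_norm_def, intro abs_of_nonneg sum_nonneg) (auto simp: u_def)
    also have "\<dots> \<le> (\<Sum>n=r ^ m..r ^ (m + 1) - 1. c n * (K2 * Q m))"
      unfolding u_def using n1 c_nonneg prob_le[OF m] by (intro sum_mono mult_left_mono) auto
    also have "\<dots> = K2 * (\<Sum>n=r ^ m..r ^ (m + 1) - 1. c n * Q m)"
      by (simp add: sum_distrib_left mult_ac)
    finally show "norm (\<Sum>n=r ^ m..r ^ (m + 1) - 1. u n) \<le> \<dots>" .
  qed
  then have "summable (\<lambda>n. u (n + 1))"
    using c_nonneg by (intro summable_of_blocks[OF r]) (auto simp: u_def)
  then show "summable (\<lambda>n. c (n + 1) *
      \<P>(\<omega> in M. (MAX j\<in>{1..n+1}. \<bar>\<Sum>k=1..j. (Xs k \<omega> - (\<integral>\<omega>'. Xs k \<omega>' \<partial>M))\<bar>) > \<epsilon> * b (n + 1)))"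
    unfolding u_def .
qed

end
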